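(* Let $(A,\circ,[\cdot,\cdot])$ be a solvable GD algebra over $\Bbbk$. If $\dim A\le 3$, then $A^{(1)}=A\circ A+[A,A]$ is nilpotent (as a GD algebra).
   Context: $\Bbbk$ is an algebraically closed field of characteristic $0$. A Novikov algebra is a vector space with a bilinear product $\circ$ satisfying $(x\circ y)\circ z-x\circ(y\circ z)=(y\circ x)\circ z-y\circ(x\circ z)$ and $(x\circ y)\circ z=(x\circ z)\circ y$. A Gelfand--Dorfman (GD) algebra is a triple $(A,\circ,[\cdot,\cdot])$ such that $(A,\circ)$ is a Novikov algebra, $(A,[\cdot,\cdot])$ is a Lie algebra, and for all $x,y,z\in A$: $[x,y\circ z]-[z,y\circ x]+[y,x]\circ z-[y,z]\circ x-y\circ[x,z]=0$. The GD derived series is $A^{(0)}=A$, $A^{(n+1)}=A^{(n)}\circ A^{(n)}+[A^{(n)},A^{(n)}]$ (linear spans); $A$ is solvable if $A^{(N)}=0$ for some $N\ge0$. A GD algebra $B$ (here $B=A^{(1)}$ with the induced operations) is nilpotent if $B^{\langle N\rangle}=0$ for some $N\ge1$, where $B^{\langle1\rangle}=B$ and $B^{\langle n+1\rangle}=\sum_{i=1}^n\bigl(B^{\langle i\rangle}\circ B^{\langle n+1-i\rangle}+[B^{\langle i\rangle},B^{\langle n+1-i\rangle}]\bigr)$. *)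

theory Defs
  imports "HOL-Computational_Algebra.Computational_Algebra"
begin

text \<open>
  Algebras live on a whole type \<open>'b\<close>, with scalars in a field \<open>'a\<close> acting by \<open>scale\<close>.
  Subalgebras are treated as subsets of \<open>'b\<close> carrying the restricted operations.
\<close>

locale bilinear_product = vector_space scale
  for scale :: "'a::field \<Rightarrow> 'b::ab_group_add \<Rightarrow> 'b" +
  fixes prd :: "'b \<Rightarrow> 'b \<Rightarrow> 'b"
  assumes linear_left: "Vector_Spaces.linear scale scale (\<lambda>x. prd x y)"
    and linear_right: "Vector_Spaces.linear scale scale (\<lambda>y. prd x y)"

locale novikov_algebra = bilinear_product scale mul
  for scale :: "'a::field \<Rightarrow> 'b::ab_group_add \<Rightarrow> 'b"
    and mul :: "'b \<Rightarrow> 'b \<Rightarrow> 'b" (infixl "\<odot>" 70) +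
  assumes left_symmetric:
      "(x \<odot> y) \<odot> z - x \<odot> (y \<odot> z) = (y \<odot> x) \<odot> z - y \<odot> (x \<odot> z)"
    and right_commutative: "(x \<odot> y) \<odot> z = (x \<odot> z) \<odot> y"

locale lie_algebra = bilinear_product scale br
  for scale :: "'a::field \<Rightarrow> 'b::ab_group_add \<Rightarrow> 'b"
    and br :: "'b \<Rightarrow> 'b \<Rightarrow> 'b" +
  assumes alternating: "br x x = 0"
    and jacobi: "br x (br y z) + br y (br z x) + br z (br x y) = 0"

locale gd_algebra = novikov_algebra scale mul + lie_algebra scale br
  for scale :: "'a::field \<Rightarrow> 'b::ab_group_add \<Rightarrow> 'b"
    and mul :: "'b \<Rightarrow> 'b \<Rightarrow> 'b" (infixl "\<odot>" 70)
    and br :: "'b \<Rightarrow> 'b \<Rightarrow> 'b" +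
  assumes gd_identity:
    "br x (y \<odot> z) - br z (y \<odot> x) + br y x \<odot> z - br y z \<odot> x - y \<odot> br x z = 0"
begin

text \<open>\<open>U \<circ> V + [U, V]\<close>; the sum of the two spans is the span of the union.\<close>

definition gd_product :: "'b set \<Rightarrow> 'b set \<Rightarrow> 'b set" where
  "gd_product U V = span ({u \<odot> v | u v. u \<in> U \<and> v \<in> V} \<union> {br u v | u v. u \<in> U \<and> v \<in> V})"

fun derived_series :: "nat \<Rightarrow> 'b set" where
  "derived_series 0 = UNIV"
| "derived_series (Suc n) = gd_product (derived_series n) (derived_series n)"

definition solvable :: bool where
  "solvable \<longleftrightarrow> (\<exists>N. derived_series N = {0})"

text \<open>
  \<open>lower_series B n\<close> is \<open>B\<^sup>\<langle>\<^sup>n\<^sup>\<rangle>\<close> for \<open>n \<ge> 1\<close>. The indexing starts at 1; the value at 0 is a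
  dummy and is excluded from \<open>nilpotent_on\<close>.
\<close>

fun lower_series :: "'b set \<Rightarrow> nat \<Rightarrow> 'b set" where
  "lower_series B n =
     (if n \<le> 1 then B
      else span (\<Union>i\<in>{1..n - 1}. gd_product (lower_series B i) (lower_series B (n - i))))"

declare lower_series.simps [simp del]

definition nilpotent_on :: "'b set \<Rightarrow> bool" where
  "nilpotent_on B \<longleftrightarrow> (\<exists>N\<ge>1. lower_series B N = {0})"

lemma lower_series_1: "lower_series B 1 = B"
  by (simp add: lower_series.simps)

lemma lower_series_Suc:
  "n \<ge> 1 \<Longrightarrow> lower_series B (n + 1) =
     span (\<Union>i\<in>{1..n}. gd_product (lower_series B i) (lower_series B (n + 1 - i)))"
  by (subst lower_series.simps) simp

lemma derived_series_1: "derived_series 1 = gd_product UNIV UNIV"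
  by simp

lemma gd_product_eq_sum:
  "gd_product U V = {a + b | a b. a \<in> span {u \<odot> v | u v. u \<in> U \<and> v \<in> V}
                                \<and> b \<in> span {br u v | u v. u \<in> U \<and> v \<in> V}}"
  unfolding gd_product_def span_Un by blast

lemma gd_product_mono: "U \<subseteq> V \<Longrightarrow> gd_product U U \<subseteq> gd_product V V"
  unfolding gd_product_def by (rule span_mono) blast

text \<open>Each term of the derived series is closed under the operations, hence a GD algebra.\<close>

lemma derived_series_closed:
  assumes "x \<in> derived_series n" "y \<in> derived_series n"
  shows "x \<odot> y \<in> derived_series n" "br x y \<in> derived_series n"
proof -
  have mono: "derived_series (Suc n) \<subseteq> derived_series n" for n
  proof (induction n)
    case (Suc n)
    then show ?case
      unfolding derived_series.simps(2) [of "Suc n"]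
      unfolding derived_series.simps(2) [of n] by (rule gd_product_mono)
  qed simp
  have "x \<odot> y \<in> derived_series (Suc n)" "br x y \<in> derived_series (Suc n)"
    unfolding derived_series.simps gd_product_def using assms by (blast intro: span_base)+
  with mono show "x \<odot> y \<in> derived_series n" "br x y \<in> derived_series n" by blast+
qed

end

end

theory Submission
  imports Defs
begin

text \<open>
  Write \<open>B = A\<^sup>(\<^sup>1\<^sup>)\<close> and \<open>C = A\<^sup>(\<^sup>2\<^sup>)\<close>. In a solvable algebra the derived series drops in dimension
  until it reaches \<open>0\<close>, so in dimension at most three either \<open>C = 0\<close>, and then \<open>B\<close> has zero
  operations, or \<open>A > B > C > 0\<close> is a full flag with \<open>B = \<langle>b, c\<rangle>\<close>, \<open>C = \<langle>c\<rangle>\<close> and \<open>C \<circ> C = 0\<close>. In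
  the second case the claim is that \<open>C\<close> is central in \<open>B\<close> (lemma \<open>derived_flag_central\<close>), which
  makes \<open>B\<^sup>\<langle>\<^sup>3\<^sup>\<rangle>\<close> vanish.

  The second term of the derived series of a GD algebra is almost an ideal: all that can
  fail is \<open>[B, B] \<circ> A \<subseteq> C\<close>, and modulo \<open>C\<close> the element \<open>[u, v] \<circ> x\<close> equals \<open>[x, u \<circ> v]\<close> (lemma
  \<open>product_of_commutator_ideal\<close>). Here \<open>[B, B]\<close> is spanned by \<open>[c, b]\<close>, and \<open>c \<circ> b = 0\<close> by left
  symmetry, so \<open>C\<close> is an ideal. Left symmetry then also gives \<open>c \<circ> A = 0\<close>.

  Hence \<open>A\<close> acts on the line \<open>C\<close> by scalars, \<open>x \<circ> c = \<chi>(x) c\<close> and \<open>[x, c] = \<omega>(x) c\<close>. Right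
  commutativity, the Jacobi identity and the GD identity become
  \<open>\<chi>(x \<circ> y) = 0\<close>, \<open>\<omega>([x, y]) = 0\<close> and \<open>\<chi>([x, y]) = - \<omega>(x \<circ> y)\<close>. Both functionals vanish on
  \<open>C\<close>. If \<open>\<chi>(b) \<noteq> 0\<close>, the first equation puts \<open>A \<circ> A\<close> inside \<open>C\<close>, so \<open>\<omega>(A \<circ> A) = 0\<close> and, by the
  third, \<open>\<chi>\<close> vanishes on \<open>A \<circ> A + [A, A] = B\<close>, a contradiction. So \<open>\<chi>(B) = 0\<close>, and then the
  third and second equations give \<open>\<omega>(B) = 0\<close>.
\<close>

section \<open>Calculus in a GD algebra\<close>

context gd_algebra
begin

lemma mul_bilinear:
  "(x + y) \<odot> z = x \<odot> z + y \<odot> z" "x \<odot> (y + z) = x \<odot> y + x \<odot> z"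
  "scale s x \<odot> z = scale s (x \<odot> z)" "x \<odot> scale s z = scale s (x \<odot> z)"
  "0 \<odot> z = 0" "x \<odot> 0 = 0" "(- x) \<odot> z = - (x \<odot> z)" "x \<odot> (- z) = - (x \<odot> z)"
proof -
  interpret l: Vector_Spaces.linear scale scale "\<lambda>x. x \<odot> u" for u
    by (rule bilinear_product.linear_left [OF novikov_algebra.axioms(1) [OF novikov_algebra_axioms]])
  interpret r: Vector_Spaces.linear scale scale "\<lambda>x. u \<odot> x" for u
    by (rule bilinear_product.linear_right [OF novikov_algebra.axioms(1) [OF novikov_algebra_axioms]])
  show "(x + y) \<odot> z = x \<odot> z + y \<odot> z" "x \<odot> (y + z) = x \<odot> y + x \<odot> z"
    "scale s x \<odot> z = scale s (x \<odot> z)" "x \<odot> scale s z = scale s (x \<odot> z)"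
    "0 \<odot> z = 0" "x \<odot> 0 = 0" "(- x) \<odot> z = - (x \<odot> z)" "x \<odot> (- z) = - (x \<odot> z)"
    by (simp_all only: l.add r.add l.scale r.scale l.zero r.zero l.neg r.neg)
qed

lemma br_bilinear:
  "br (x + y) z = br x z + br y z" "br x (y + z) = br x y + br x z"
  "br (scale s x) z = scale s (br x z)" "br x (scale s z) = scale s (br x z)"
  "br 0 z = 0" "br x 0 = 0" "br (- x) z = - br x z" "br x (- z) = - br x z"
proof -
  interpret l: Vector_Spaces.linear scale scale "\<lambda>x. br x u" for u
    by (rule bilinear_product.linear_left [OF lie_algebra.axioms(1) [OF lie_algebra_axioms]])
  interpret r: Vector_Spaces.linear scale scale "\<lambda>x. br u x" for u
    by (rule bilinear_product.linear_right [OF lie_algebra.axioms(1) [OF lie_algebra_axioms]])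
  show "br (x + y) z = br x z + br y z" "br x (y + z) = br x y + br x z"
    "br (scale s x) z = scale s (br x z)" "br x (scale s z) = scale s (br x z)"
    "br 0 z = 0" "br x 0 = 0" "br (- x) z = - br x z" "br x (- z) = - br x z"
    by (simp_all only: l.add r.add l.scale r.scale l.zero r.zero l.neg r.neg)
qed

lemma br_antisym: "br y x = - br x y"
proof -
  have "br (x + y) (x + y) = br x y + br y x"
    by (simp only: br_bilinear) (simp add: alternating)
  then show ?thesis
    by (simp add: alternating eq_neg_iff_add_eq_0 add.commute)
qed

lemma gd_product_mul: "u \<in> U \<Longrightarrow> v \<in> V \<Longrightarrow> u \<odot> v \<in> gd_product U V"
  and gd_product_br: "u \<in> U \<Longrightarrow> v \<in> V \<Longrightarrow> br u v \<in> gd_product U V"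
  unfolding gd_product_def by (blast intro: span_base)+

lemma subspace_gd_product: "subspace (gd_product U V)"
  unfolding gd_product_def by (rule subspace_span)

lemma gd_product_induct [consumes 1, case_names subspace mul br]:
  assumes "w \<in> gd_product U V" "subspace {w. P w}"
    "\<And>u v. u \<in> U \<Longrightarrow> v \<in> V \<Longrightarrow> P (u \<odot> v)" "\<And>u v. u \<in> U \<Longrightarrow> v \<in> V \<Longrightarrow> P (br u v)"
  shows "P w"
  using assms(1) unfolding gd_product_def
  by (rule span_induct) (use assms(2-4) in auto)

lemma gd_product_eq_zero:
  assumes "\<And>u v. u \<in> U \<Longrightarrow> v \<in> V \<Longrightarrow> u \<odot> v = 0" "\<And>u v. u \<in> U \<Longrightarrow> v \<in> V \<Longrightarrow> br u v = 0"
  shows "gd_product U V = {0}"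
proof -
  have "w = 0" if "w \<in> gd_product U V" for w
    using that by (induction rule: gd_product_induct) (simp_all add: assms subspace_def)
  then show ?thesis using subspace_0 [OF subspace_gd_product] by blast
qed

text \<open>
  On the line spanned by \<open>c\<close> left and right multiplication by \<open>x\<close> are scalars \<open>t\<close> and \<open>r\<close>, which
  commute; so left symmetry for \<open>c, x, x\<close> collapses to \<open>r\<^sup>2 c = c \<circ> (x \<circ> x)\<close>.
\<close>

lemma annihilated_of_eigenvector:
  assumes cx: "c \<odot> x = scale r c" and xc: "x \<odot> c = scale t c" and "c \<odot> (x \<odot> x) = 0"
  shows "c \<odot> x = 0"
proof -
  have "scale (r * r) c = 0"
    using left_symmetric [of c x x] assms by (simp add: mul_bilinear mult.commute)
  then show ?thesis using cx by auto
qed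

text \<open>
  Each identity of a GD algebra, solved for the terms in which \<open>x\<close> acts on a product of \<open>u\<close> and
  \<open>v\<close>, expresses them through products of elements of \<open>B\<close>. The GD identity can be solved
  in two ways: for \<open>x \<circ> [u, v]\<close>, or for \<open>[x, u \<circ> v] - [u, v] \<circ> x\<close>, whose two parts it does not
  separate. That difference is why \<open>A\<^sup>(\<^sup>2\<^sup>)\<close> is not visibly an ideal of \<open>A\<close>.
\<close>

lemma product_of_commutator_ideal:
  assumes products: "\<And>x y. x \<odot> y \<in> B" "\<And>x y. br x y \<in> B"
    and uv: "u \<in> B" "v \<in> B"
  shows "(u \<odot> v) \<odot> x \<in> gd_product B B"
    and "x \<odot> (u \<odot> v) \<in> gd_product B B"
    and "x \<odot> br u v \<in> gd_product B B"
    and "br x (br u v) \<in> gd_product B B"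
    and "br x (u \<odot> v) - br u v \<odot> x \<in> gd_product B B"
proof -
  note in_product = gd_product_mul gd_product_br products uv
  note closed = subspace_add [OF subspace_gd_product] subspace_diff [OF subspace_gd_product]
  show "(u \<odot> v) \<odot> x \<in> gd_product B B"
    unfolding right_commutative [of u v x] by (intro in_product)
  have "x \<odot> (u \<odot> v) = (x \<odot> u) \<odot> v - (u \<odot> x) \<odot> v + u \<odot> (x \<odot> v)"
    using left_symmetric [of x u v] by (simp add: algebra_simps)
  also have "\<dots> \<in> gd_product B B"
    by (intro closed in_product)
  finally show "x \<odot> (u \<odot> v) \<in> gd_product B B" .
  have "x \<odot> br u v = br u (x \<odot> v) - br v (x \<odot> u) + br x u \<odot> v - br x v \<odot> u"
    using gd_identity [of u x v] by (simp add: algebra_simps)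
  also have "\<dots> \<in> gd_product B B"
    by (intro closed in_product)
  finally show "x \<odot> br u v \<in> gd_product B B" .
  \<comment> \<open>The leading \<open>0\<close> makes the right-hand side a chain of differences of products.\<close>
  have "br x (br u v) = 0 - br u (br v x) - br v (br x u)"
    using jacobi [of x u v] by (simp add: algebra_simps eq_neg_iff_add_eq_0)
  also have "\<dots> \<in> gd_product B B"
    by (intro closed in_product subspace_0 [OF subspace_gd_product])
  finally show "br x (br u v) \<in> gd_product B B" .
  have "br x (u \<odot> v) - br u v \<odot> x = br v (u \<odot> x) - br u x \<odot> v + u \<odot> br x v"
    using gd_identity [of x u v] by (simp add: algebra_simps br_antisym [of x u] mul_bilinear)
  also have "\<dots> \<in> gd_product B B"
    by (intro closed in_product)
  finally show "br x (u \<odot> v) - br u v \<odot> x \<in> gd_product B B" .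
qed

section \<open>Centrality of the second derived term\<close>

lemma span_pair: "u \<in> span {b, c} \<longleftrightarrow> (\<exists>s t. u = scale s b + scale t c)"
  by (simp add: span_breakdown_eq [of u b "{c}"] span_singleton image_iff diff_eq_eq add.commute)

text \<open>
  The core of the argument: first \<open>C = \<langle>c\<rangle>\<close> is shown to be an ideal of \<open>A\<close> with \<open>C \<circ> A = 0\<close>, then
  the scalars by which \<open>A\<close> acts on \<open>C\<close> are compared.
\<close>

lemma derived_flag_central:
  assumes B: "gd_product UNIV UNIV = span {b, c}"
    and C: "gd_product (span {b, c}) (span {b, c}) = span {c}"
    and cc: "c \<odot> c = 0"
  shows "b \<odot> c = 0" "c \<odot> b = 0" "br b c = 0"
proof -
  have in_B: "x \<odot> y \<in> span {b, c}" "br x y \<in> span {b, c}" for x y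
    unfolding B [symmetric] by (simp_all add: gd_product_mul gd_product_br)
  have b: "b \<in> span {b, c}" and c: "c \<in> span {b, c}"
    by (simp_all add: span_base)
  have in_C: "u \<odot> v \<in> span {c}" "br u v \<in> span {c}" if "u \<in> span {b, c}" "v \<in> span {b, c}" for u v
    unfolding C [symmetric] using that by (simp_all add: gd_product_mul gd_product_br)
  have B_E: thesis if "u \<in> span {b, c}" "\<And>s t. u = scale s b + scale t c \<Longrightarrow> thesis" for u thesis
    using that span_pair by blast
  have C_E: "\<exists>t. u = scale t c" if "u \<in> span {c}" for u
    using that by (auto simp: span_singleton)

  have cC: "c \<odot> u = 0" if "u \<in> span {c}" for u
    using C_E [OF that] by (auto simp: mul_bilinear cc)
  show cb: "c \<odot> b = 0"
    using C_E [OF in_C(1) [OF c b]] C_E [OF in_C(1) [OF b c]]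
      annihilated_of_eigenvector [of c b] cC [OF in_C(1) [OF b b]] by auto
  have cB: "c \<odot> u = 0" if "u \<in> span {b, c}" for u
    using that by (rule B_E) (simp add: mul_bilinear cc cb)

  note closure = product_of_commutator_ideal [where B = "span {b, c}", unfolded C, OF in_B]
  \<comment> \<open>The obstruction for \<open>[c, b]\<close> is \<open>[x, c \<circ> b] = 0\<close>; reversing the roles of \<open>b\<close> and \<open>c\<close> would
      leave the unknown \<open>[x, b \<circ> c]\<close>.\<close>
  have bcx: "br b c \<odot> x \<in> span {c}" for x
  proof -
    have "br c b \<odot> x \<in> span {c}"
      using closure(5) [OF c b, of x] span_neg by (fastforce simp: cb br_bilinear)
    then show ?thesis
      using span_neg [of "br c b \<odot> x" "{c}"] by (simp add: br_antisym [of b c] mul_bilinear)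
  qed
  have brx: "br u v \<odot> x \<in> span {c}" if u: "u \<in> span {b, c}" and v: "v \<in> span {b, c}" for u v x
  proof -
    obtain s t where "u = scale s b + scale t c" using u by (rule B_E)
    moreover obtain s' t' where "v = scale s' b + scale t' c" using v by (rule B_E)
    ultimately have "br u v = scale (s * t' - t * s') (br b c)"
      by (simp add: br_bilinear alternating br_antisym [of c b] scale_left_diff_distrib
          scale_minus_right scale_right_distrib mult.commute)
    then show ?thesis by (simp add: mul_bilinear span_scale bcx)
  qed
  have "w \<odot> x \<in> span {c} \<and> x \<odot> w \<in> span {c} \<and> br x w \<in> span {c}"
    if "w \<in> gd_product (span {b, c}) (span {b, c})" for w x
    using that
  proof (induction rule: gd_product_induct)
    case subspace
    show ?case
      by (auto simp: subspace_def mul_bilinear br_bilinear span_zero span_add span_scale)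
  next
    case (mul u v)
    have "br x (u \<odot> v) \<in> span {c}"
      using span_add [OF closure(5) [OF mul, of x] brx [OF mul, of x]] by simp
    then show ?case using closure(1,2) [OF mul] by blast
  next
    case (br u v)
    then show ?case using closure(3,4) [OF br] brx by blast
  qed
  then have ideal: "c \<odot> x \<in> span {c}" "x \<odot> c \<in> span {c}" "br x c \<in> span {c}" for x
    by (simp_all add: C span_base)
  have cA: "c \<odot> x = 0" for x
    using C_E [of "c \<odot> x"] C_E [of "x \<odot> c"] ideal [of x]
      annihilated_of_eigenvector [of c x] cB [OF in_B(1)] by auto

  \<comment> \<open>The three relations \<open>\<chi>(x \<circ> y) = 0\<close>, \<open>\<omega>([x, y]) = 0\<close> and \<open>\<chi>([x, y]) = - \<omega>(x \<circ> y)\<close>, where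
      \<open>x \<circ> c = \<chi>(x) c\<close> and \<open>[x, c] = \<omega>(x) c\<close>.\<close>
  have mul_c: "(x \<odot> y) \<odot> c = 0" for x y
  proof -
    obtain t where "x \<odot> c = scale t c" using C_E ideal by blast
    then show ?thesis by (simp add: right_commutative [of x y c] mul_bilinear cA)
  qed
  have br_br_c: "br (br x y) c = 0" for x y
  proof -
    obtain s t where st: "br x c = scale s c" "br y c = scale t c" using C_E ideal by metis
    have "br c x = - scale s c"
      using st br_antisym [of c x] by simp
    then have "br c (br x y) = 0"
      using jacobi [of c x y] st by (simp add: br_bilinear mult.commute)
    then show ?thesis by (simp add: br_antisym [of "br x y" c])
  qed
  have br_c: "br x y \<odot> c = - br (x \<odot> y) c" for x y
  proof -
    obtain r s t where "br x c = scale r c" "x \<odot> c = scale s c" "br y c = scale t c"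
      using C_E ideal by metis
    \<comment> \<open>Of the five terms of the GD identity for \<open>c, x, y\<close>, one vanishes by \<open>c \<circ> A = 0\<close> and
        \<open>[y, x \<circ> c]\<close> cancels against \<open>x \<circ> [c, y]\<close>, both being \<open>\<plusminus> s t c\<close>.\<close>
    then show ?thesis
      using gd_identity [of c x y]
      by (simp add: cA br_bilinear mul_bilinear br_antisym [of c] mult.commute)
  qed
  have B_vanish: "P b" if "subspace {w. P w}" "\<And>x y. P (x \<odot> y)" "\<And>x y. P (br x y)" for P
  proof -
    have "b \<in> gd_product UNIV UNIV" by (simp add: B b)
    then show ?thesis by (induction rule: gd_product_induct) (use that in auto)
  qed

  show bc: "b \<odot> c = 0"
  proof (rule ccontr)
    assume nz: "b \<odot> c \<noteq> 0"
    \<comment> \<open>\<open>\<chi>(x \<circ> y) = 0\<close> and \<open>\<chi>(b) \<noteq> 0\<close> force \<open>x \<circ> y\<close> into \<open>C\<close>, where \<open>\<omega>\<close> vanishes.\<close>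
    have "br (x \<odot> y) c = 0" for x y
    proof -
      obtain s t where st: "x \<odot> y = scale s b + scale t c"
        using in_B(1) by (rule B_E)
      then have "scale s (b \<odot> c) = 0"
        using mul_c [of x y] by (simp add: mul_bilinear cc)
      then show ?thesis using nz by (simp add: st br_bilinear alternating)
    qed
    then have "b \<odot> c = 0"
      by (intro B_vanish [of "\<lambda>w. w \<odot> c = 0"])
        (simp_all add: subspace_def mul_bilinear mul_c br_c)
    with nz show False ..
  qed
  have Bc: "u \<odot> c = 0" if "u \<in> span {b, c}" for u
    using that by (rule B_E) (simp add: mul_bilinear bc cc)
  have "br (x \<odot> y) c = 0" for x y
    using br_c [of x y] Bc [OF in_B(2)] by simp
  then show "br b c = 0"
    by (intro B_vanish [of "\<lambda>w. br w c = 0"]) (simp_all add: subspace_def br_bilinear br_br_c)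
qed

section \<open>The derived and lower series\<close>

lemma subspace_derived_series: "subspace (derived_series n)"
  by (cases n) (simp_all add: subspace_gd_product)

lemma derived_series_antimono: "derived_series (Suc n) \<subseteq> derived_series n"
proof (induction n)
  case (Suc n)
  then show ?case
    unfolding derived_series.simps(2) [of "Suc n"]
    unfolding derived_series.simps(2) [of n] by (rule gd_product_mono)
qed simp

lemma derived_series_stays_zero:
  assumes "derived_series n = {0}" "n \<le> m"
  shows "derived_series m = {0}"
  using assms(2)
proof (induction m rule: dec_induct)
  case (step m)
  then show ?case
    using gd_product_eq_zero [of "{0}" "{0}"] by (simp add: mul_bilinear br_bilinear)
qed (rule assms(1))

text \<open>If two consecutive terms agree, the series is constant from there on.\<close>

lemma derived_series_strict:
  assumes solvable and "derived_series n \<noteq> {0}"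
  shows "derived_series (Suc n) \<subset> derived_series n"
proof -
  have False if eq: "derived_series (Suc n) = derived_series n"
  proof -
    have "derived_series (n + k) = derived_series n" for k
      by (induction k) (use eq in simp_all)
    moreover obtain N where N: "derived_series N = {0}"
      using assms(1) unfolding solvable_def by blast
    moreover have "derived_series (n + N) = {0}"
      using N by (rule derived_series_stays_zero) simp
    ultimately show False using assms(2) by simp
  qed
  then show ?thesis using derived_series_antimono by blast
qed

lemma lower_series_2: "lower_series B 2 = gd_product B B"
  using lower_series_Suc [of 1 B]
  by (simp add: numeral_2_eq_2 lower_series_1 [unfolded One_nat_def] span_eq_iff subspace_gd_product)

lemma lower_series_3:
  "lower_series B 3 = span (gd_product B (gd_product B B) \<union> gd_product (gd_product B B) B)"
proof -
  have "{1..2::nat} = {1, 2}" by auto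
  then show ?thesis
    using lower_series_Suc [of 2 B] by (simp add: lower_series_1 [unfolded One_nat_def] lower_series_2)
qed

end

section \<open>Algebras of dimension at most three\<close>

theorem proposition4p7:
  fixes scale :: "'a::{alg_closed_field, field_char_0} \<Rightarrow> 'b::ab_group_add \<Rightarrow> 'b"
    and mul br :: "'b \<Rightarrow> 'b \<Rightarrow> 'b"
    and Basis :: "'b set"
  assumes "gd_algebra scale mul br"
    and "finite_dimensional_vector_space scale Basis"
    and "vector_space.dim scale (UNIV :: 'b set) \<le> 3"
    and "gd_algebra.solvable scale mul br"
  shows "gd_algebra.nilpotent_on scale mul br (gd_algebra.derived_series scale mul br 1)"
proof -
  interpret gd_algebra scale mul br by fact
  interpret fd: finite_dimensional_vector_space scale Basis by fact
  let ?B = "derived_series 1" and ?C = "derived_series 2"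
  have C_eq: "?C = gd_product ?B ?B" by (simp add: numeral_2_eq_2)
  have dim_less: "dim (derived_series (Suc n)) < dim (derived_series n)"
    if "derived_series n \<noteq> {0}" for n
    using derived_series_strict [OF assms(4) that] subspace_derived_series
    by (metis fd.dim_psubset span_eq_iff)
  show ?thesis
  proof (cases "?C = {0}")
    case True
    then have "lower_series ?B 2 = {0}" by (simp only: lower_series_2 C_eq)
    then show ?thesis unfolding nilpotent_on_def by (intro exI [of _ 2]) simp
  next
    case False
    have nonzero: "derived_series 0 \<noteq> {0}" "?B \<noteq> {0}"
      using False derived_series_stays_zero [of 0 2] derived_series_stays_zero [of 1 2]
      by (meson zero_le one_le_numeral)+
    have "dim ?B < dim UNIV" "dim ?C < dim ?B" "dim (derived_series 3) < dim ?C"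
      using dim_less [OF nonzero(1)] dim_less [OF nonzero(2)] dim_less [OF False]
      by (simp_all only: derived_series.simps(1) One_nat_def [symmetric] Suc_1 Suc_numeral arith_simps)
    then have dims: "dim ?B \<le> 2" "dim ?C \<le> 1" "dim (derived_series 3) = 0"
      using assms(3) by linarith+
    obtain c where c: "c \<in> ?C" "c \<noteq> 0"
      using False subspace_0 [OF subspace_derived_series, of 2] by blast
    obtain b where b: "b \<in> ?B" "b \<notin> ?C"
      using derived_series_strict [OF assms(4) nonzero(2)] by (auto simp: numeral_2_eq_2)
    have C_span: "?C = span {c}"
    proof
      show "?C \<subseteq> span {c}"
        using c dims by (intro fd.card_ge_dim_independent) auto
      show "span {c} \<subseteq> ?C"
        using c by (intro span_minimal subspace_derived_series) auto
    qed
    have CB: "?C \<subseteq> ?B" using derived_series_antimono [of 1] by (simp add: numeral_2_eq_2)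
    have "b \<noteq> c" using b c by auto
    have B_span: "?B = span {b, c}"
    proof
      show "?B \<subseteq> span {b, c}"
        using b c dims CB C_span \<open>b \<noteq> c\<close>
        by (intro fd.card_ge_dim_independent) (auto simp: independent_insert)
      show "span {b, c} \<subseteq> ?B"
        using b c CB by (intro span_minimal subspace_derived_series) auto
    qed
    have "mul c c \<in> derived_series 3"
      using c gd_product_mul [of c ?C c ?C] by (simp add: numeral_2_eq_2 numeral_3_eq_3)
    then have cc: "mul c c = 0"
      using dims(3) by (simp add: fd.dim_eq_0) blast
    have flag: "gd_product UNIV UNIV = span {b, c}"
      "gd_product (span {b, c}) (span {b, c}) = span {c}"
      using B_span C_span C_eq by simp_all
    note central = derived_flag_central [OF flag cc]
    have "gd_product ?B ?C = {0}" "gd_product ?C ?B = {0}"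
      unfolding B_span C_span
      by (rule gd_product_eq_zero;
          auto simp: span_pair span_singleton mul_bilinear br_bilinear central cc alternating
            br_antisym [of c b])+
    then have "lower_series ?B 3 = {0}"
      unfolding lower_series_3 C_eq [symmetric] by (simp del: derived_series.simps)
    then show ?thesis unfolding nilpotent_on_def by (intro exI [of _ 3]) simp
  qed
qed

end
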